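(* Let $Q$ be a finite quandle, let $\alpha: Tor(Z_0)\oplus Z_0/Tor(Z_0)\to Z_0$ be an isomorphism of groups, and let $\overline{\theta}_{G(Q)}:G(Q)_\alpha\to Inn(Q)$ be the morphism induced by $\theta_{G(Q)}$. 1) The extension $\overline{\theta}_{G(Q)}:G(Q)_\alpha\to Inn(Q)$ is a stem extension with nucleus isomorphic to the finite group $Tor(Z_0)$. 2) The group $G(Q)_\alpha$ is finite.
   Context: A quandle is a set $Q$ with a binary operation $\triangleright$ such that $x\triangleright x=x$; $x\triangleright(y\triangleright z)=(x\triangleright y)\triangleright(x\triangleright z)$; and for all $x,y\in Q$ there is a unique $z\in Q$ with $x\triangleright z=y$. For $x\in Q$, $L_x:Q\to Q$ is the bijection $L_x(y)=x\triangleright y$; $Inn(Q)$ is the group of bijections of $Q$ generated by all $L_x$. The enveloping group is $G(Q)=\langle x\in Q\mid xyx^{-1}=x\triangleright y,\ x,y\in Q\rangle$. $\theta_{G(Q)}:G(Q)\to Inn(Q)$ is the surjective group morphism sending the generator $x$ to $L_x$, and $Z_0=\ker\theta_{G(Q)}$. It is known that $Z_0$ is contained in the center of $G(Q)$; for $Q$ finite, $Z_0$ is a finitely generated abelian group, with finite torsion subgroup $Tor(Z_0)$. Given an isomorphism $\alpha$ as in the claim, $G(Q)_\alpha=G(Q)/\alpha(Z_0/Tor(Z_0))$; $\theta_{G(Q)}$ factors through the quotient map $G(Q)\to G(Q)_\alpha$ as the morphism $\overline{\theta}_{G(Q)}$. A stem extension is a surjective group morphism $G\to H$ whose kernel (the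 nucleus) is contained in the center of $G$ and in the derived subgroup of $G$. *)

theory Defs
  imports "HOL-Algebra.Bij" "HOL-Algebra.Generated_Groups"
begin

section \<open>Quandles and their inner groups\<close>

locale quandle =
  fixes Q :: "'a set" and op :: "'a \<Rightarrow> 'a \<Rightarrow> 'a" (infixr \<open>\<triangleright>\<close> 70)
  assumes op_closed: "\<lbrakk>x \<in> Q; y \<in> Q\<rbrakk> \<Longrightarrow> x \<triangleright> y \<in> Q"
    and idem: "x \<in> Q \<Longrightarrow> x \<triangleright> x = x"
    and self_distrib: "\<lbrakk>x \<in> Q; y \<in> Q; z \<in> Q\<rbrakk> \<Longrightarrow> x \<triangleright> (y \<triangleright> z) = (x \<triangleright> y) \<triangleright> (x \<triangleright> z)"
    and unique_solution: "\<lbrakk>x \<in> Q; y \<in> Q\<rbrakk> \<Longrightarrow> \<exists>!z. z \<in> Q \<and> x \<triangleright> z = y"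

definition left_translation :: "'a set \<Rightarrow> ('a \<Rightarrow> 'a \<Rightarrow> 'a) \<Rightarrow> 'a \<Rightarrow> 'a \<Rightarrow> 'a" where
  "left_translation Q op x = (\<lambda>y\<in>Q. op x y)"

definition Inn :: "'a set \<Rightarrow> ('a \<Rightarrow> 'a \<Rightarrow> 'a) \<Rightarrow> ('a \<Rightarrow> 'a) monoid" where
  "Inn Q op =
     (BijGroup Q)\<lparr>carrier := generate (BijGroup Q) (left_translation Q op ` Q)\<rparr>"


section \<open>Groups given by generators and relations\<close>

text \<open>A word is a list of letters \<open>(x, b)\<close>, where \<open>(x, True)\<close> stands for the generator \<open>x\<close>
  and \<open>(x, False)\<close> for its formal inverse.  A relation \<open>u = v\<close> is the pair \<open>(u, v)\<close>.\<close>

type_synonym 'a word = "('a \<times> bool) list"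

definition words :: "'a set \<Rightarrow> 'a word set" where
  "words X = lists (X \<times> UNIV)"

inductive_set word_cong :: "'a set \<Rightarrow> ('a word \<times> 'a word) set \<Rightarrow> ('a word \<times> 'a word) set"
  for X :: "'a set" and R :: "('a word \<times> 'a word) set" where
  refl: "u \<in> words X \<Longrightarrow> (u, u) \<in> word_cong X R"
| sym: "(u, v) \<in> word_cong X R \<Longrightarrow> (v, u) \<in> word_cong X R"
| trans: "(u, v) \<in> word_cong X R \<Longrightarrow> (v, w) \<in> word_cong X R \<Longrightarrow> (u, w) \<in> word_cong X R"
| append: "(u, v) \<in> word_cong X R \<Longrightarrow> (u', v') \<in> word_cong X R \<Longrightarrow> (u @ u', v @ v') \<in> word_cong X R"
| cancel: "x \<in> X \<Longrightarrow> ([(x, b), (x, \<not> b)], []) \<in> word_cong X R"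
| rel: "(u, v) \<in> R \<Longrightarrow> u \<in> words X \<Longrightarrow> v \<in> words X \<Longrightarrow> (u, v) \<in> word_cong X R"

definition presented_group :: "'a set \<Rightarrow> ('a word \<times> 'a word) set \<Rightarrow> 'a word set monoid" where
  "presented_group X R =
     \<lparr>carrier = words X // word_cong X R,
      mult = (\<lambda>A B. \<Union>u\<in>A. \<Union>v\<in>B. word_cong X R `` {u @ v}),
      one = word_cong X R `` {[]}\<rparr>"

definition generator :: "'a set \<Rightarrow> ('a word \<times> 'a word) set \<Rightarrow> 'a \<Rightarrow> 'a word set" where
  "generator X R x = word_cong X R `` {[(x, True)]}"

fun word_eval :: "('b, 'c) monoid_scheme \<Rightarrow> ('a \<Rightarrow> 'b) \<Rightarrow> 'a word \<Rightarrow> 'b" where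
  "word_eval H f [] = \<one>\<^bsub>H\<^esub>"
| "word_eval H f ((x, b) # w) = (if b then f x else inv\<^bsub>H\<^esub> (f x)) \<otimes>\<^bsub>H\<^esub> word_eval H f w"

text \<open>If \<open>f\<close> respects the relations, \<open>word_eval H f\<close> is constant on each class, and
  \<open>presented_lift H f\<close> is the morphism sending the class of each generator \<open>x\<close> to \<open>f x\<close>;
  see \<open>presented_lift_hom\<close> and \<open>presented_lift_generator\<close> below.\<close>

definition presented_lift :: "('b, 'c) monoid_scheme \<Rightarrow> ('a \<Rightarrow> 'b) \<Rightarrow> 'a word set \<Rightarrow> 'b" where
  "presented_lift H f C = the_elem (word_eval H f ` C)"

lemma words_simps [simp]:
  "[] \<in> words X"
  "a # w \<in> words X \<longleftrightarrow> fst a \<in> X \<and> w \<in> words X"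
  "u @ v \<in> words X \<longleftrightarrow> u \<in> words X \<and> v \<in> words X"
  by (auto simp: words_def mem_Times_iff)

lemma word_cong_words: "(u, v) \<in> word_cong X R \<Longrightarrow> u \<in> words X \<and> v \<in> words X"
  by (induction rule: word_cong.induct) auto

lemma equiv_word_cong: "equiv (words X) (word_cong X R)"
proof (rule equivI)
  show "word_cong X R \<subseteq> words X \<times> words X"
    using word_cong_words by auto
  show "refl_on (words X) (word_cong X R)"
    by (auto intro!: refl_onI word_cong.refl dest: word_cong_words)
  show "sym (word_cong X R)" by (auto intro: symI word_cong.sym)
  show "trans (word_cong X R)" by (auto intro: transI word_cong.trans)
qed

lemma presented_mult_class:
  assumes "u \<in> words X" "v \<in> words X"
  shows "(word_cong X R `` {u}) \<otimes>\<^bsub>presented_group X R\<^esub> (word_cong X R `` {v}) = word_cong X R `` {u @ v}"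
proof -
  have "word_cong X R `` {u' @ v'} = word_cong X R `` {u @ v}"
    if "(u, u') \<in> word_cong X R" "(v, v') \<in> word_cong X R" for u' v'
    using equiv_class_eq[OF equiv_word_cong word_cong.append[OF that]] by simp
  moreover have "(u, u) \<in> word_cong X R" "(v, v) \<in> word_cong X R"
    using assms by (auto intro: word_cong.refl)
  ultimately have "(\<Union>u'\<in>word_cong X R `` {u}. \<Union>v'\<in>word_cong X R `` {v}. word_cong X R `` {u' @ v'})
      = word_cong X R `` {u @ v}"
    by blast
  then show ?thesis by (simp add: presented_group_def)
qed

lemma presented_carrierE:
  assumes "A \<in> carrier (presented_group X R)"
  obtains u where "u \<in> words X" "A = word_cong X R `` {u}"
  using assms by (auto simp: presented_group_def elim: quotientE)

lemma presented_carrierI: "u \<in> words X \<Longrightarrow> word_cong X R `` {u} \<in> carrier (presented_group X R)"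
  by (simp add: presented_group_def quotientI)

lemma presented_one: "\<one>\<^bsub>presented_group X R\<^esub> = word_cong X R `` {[]}"
  by (simp add: presented_group_def)

lemma word_left_inverse:
  "u \<in> words X \<Longrightarrow> \<exists>v\<in>words X. (v @ u, []) \<in> word_cong X R"
proof (induction u)
  case Nil
  then show ?case by (auto intro!: bexI[of _ "[]"] word_cong.refl)
next
  case (Cons a u)
  obtain x b where a: "a = (x, b)" by force
  from Cons obtain v where v: "v \<in> words X" "(v @ u, []) \<in> word_cong X R" by auto
  have x: "x \<in> X" and u: "u \<in> words X" using Cons.prems a by auto
  have "([(x, \<not> b), (x, b)], []) \<in> word_cong X R"
    using word_cong.cancel[OF x, of "\<not> b" R] by simp
  then have "([(x, \<not> b), (x, b)] @ u, [] @ u) \<in> word_cong X R"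
    by (rule word_cong.append[OF _ word_cong.refl[OF u]])
  then have "(v @ [(x, \<not> b), (x, b)] @ u, v @ [] @ u) \<in> word_cong X R"
    by (rule word_cong.append[OF word_cong.refl[OF v(1)]])
  then have "((v @ [(x, \<not> b)]) @ a # u, []) \<in> word_cong X R"
    using v(2) a by (auto intro: word_cong.trans)
  then show ?case using v x by (intro bexI[of _ "v @ [(x, \<not> b)]"]) auto
qed

lemma group_presented_group: "group (presented_group X R)"
proof (rule groupI)
  fix A B C
  assume A: "A \<in> carrier (presented_group X R)"
  obtain u where u: "u \<in> words X" "A = word_cong X R `` {u}"
    using A by (rule presented_carrierE)
  show "\<one>\<^bsub>presented_group X R\<^esub> \<otimes>\<^bsub>presented_group X R\<^esub> A = A"
    using presented_mult_class[of "[]" X u R] u by (simp add: presented_one)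
  obtain v where v: "v \<in> words X" "(v @ u, []) \<in> word_cong X R"
    using word_left_inverse[OF u(1), of R] by auto
  then have "(word_cong X R `` {v}) \<otimes>\<^bsub>presented_group X R\<^esub> A = \<one>\<^bsub>presented_group X R\<^esub>"
    using u equiv_class_eq[OF equiv_word_cong v(2)]
    by (simp add: presented_mult_class presented_one)
  then show "\<exists>y\<in>carrier (presented_group X R). y \<otimes>\<^bsub>presented_group X R\<^esub> A = \<one>\<^bsub>presented_group X R\<^esub>"
    using presented_carrierI[OF v(1)] by blast
  assume B: "B \<in> carrier (presented_group X R)"
  obtain w where w: "w \<in> words X" "B = word_cong X R `` {w}"
    using B by (rule presented_carrierE)
  show "A \<otimes>\<^bsub>presented_group X R\<^esub> B \<in> carrier (presented_group X R)"
    using u w by (simp add: presented_mult_class presented_carrierI)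
  assume C: "C \<in> carrier (presented_group X R)"
  obtain z where z: "z \<in> words X" "C = word_cong X R `` {z}"
    using C by (rule presented_carrierE)
  show "A \<otimes>\<^bsub>presented_group X R\<^esub> B \<otimes>\<^bsub>presented_group X R\<^esub> C
      = A \<otimes>\<^bsub>presented_group X R\<^esub> (B \<otimes>\<^bsub>presented_group X R\<^esub> C)"
    using u w z by (simp add: presented_mult_class)
next
  show "\<one>\<^bsub>presented_group X R\<^esub> \<in> carrier (presented_group X R)"
    by (simp add: presented_one presented_carrierI)
qed

context
  fixes H :: "('b, 'c) monoid_scheme" and f :: "'a \<Rightarrow> 'b"
    and X :: "'a set" and R :: "('a word \<times> 'a word) set"
  assumes H: "group H" and f: "f \<in> X \<rightarrow> carrier H"
    and R: "\<And>u v. (u, v) \<in> R \<Longrightarrow> u \<in> words X \<Longrightarrow> v \<in> words X \<Longrightarrow> word_eval H f u = word_eval H f v"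
begin

interpretation group H by (rule H)

lemma word_eval_closed: "u \<in> words X \<Longrightarrow> word_eval H f u \<in> carrier H"
  using f by (induction u) (auto simp: Pi_iff)

lemma word_eval_append:
  "u \<in> words X \<Longrightarrow> v \<in> words X \<Longrightarrow> word_eval H f (u @ v) = word_eval H f u \<otimes>\<^bsub>H\<^esub> word_eval H f v"
proof (induction u)
  case (Cons a u)
  then show ?case using f by (cases a) (auto simp: word_eval_closed m_assoc Pi_iff)
qed (auto simp: word_eval_closed)

lemma word_eval_cong: "(u, v) \<in> word_cong X R \<Longrightarrow> word_eval H f u = word_eval H f v"
proof (induction rule: word_cong.induct)
  case (append u v u' v')
  then show ?case using word_cong_words[OF append.hyps(1)] word_cong_words[OF append.hyps(2)]
    by (simp add: word_eval_append)
next
  case (cancel x b)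
  then show ?case using f by (auto simp: Pi_iff)
qed (auto simp: R)

lemma presented_lift_class:
  "u \<in> words X \<Longrightarrow> presented_lift H f (word_cong X R `` {u}) = word_eval H f u"
  unfolding presented_lift_def
  by (rule the_elem_image_unique) (auto intro: word_cong.refl dest: word_eval_cong)

lemma presented_lift_hom: "presented_lift H f \<in> hom (presented_group X R) H"
proof (rule homI)
  fix A assume "A \<in> carrier (presented_group X R)"
  then obtain u where u: "u \<in> words X" "A = word_cong X R `` {u}" by (rule presented_carrierE)
  then show "presented_lift H f A \<in> carrier H" by (simp add: presented_lift_class word_eval_closed)
  fix B assume "B \<in> carrier (presented_group X R)"
  then obtain v where v: "v \<in> words X" "B = word_cong X R `` {v}" by (rule presented_carrierE)
  with u show "presented_lift H f (A \<otimes>\<^bsub>presented_group X R\<^esub> B)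
      = presented_lift H f A \<otimes>\<^bsub>H\<^esub> presented_lift H f B"
    by (simp add: presented_lift_class presented_mult_class word_eval_append)
qed

lemma presented_lift_generator: "x \<in> X \<Longrightarrow> presented_lift H f (generator X R x) = f x"
  unfolding generator_def using f by (subst presented_lift_class) (auto simp: Pi_iff)

end


section \<open>The enveloping group\<close>

definition env_relations :: "'a set \<Rightarrow> ('a \<Rightarrow> 'a \<Rightarrow> 'a) \<Rightarrow> ('a word \<times> 'a word) set" where
  "env_relations Q op =
     {([(x, True), (y, True), (x, False)], [(op x y, True)]) | x y. x \<in> Q \<and> y \<in> Q}"

definition env_group :: "'a set \<Rightarrow> ('a \<Rightarrow> 'a \<Rightarrow> 'a) \<Rightarrow> 'a word set monoid" where
  "env_group Q op = presented_group Q (env_relations Q op)"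

definition env_theta :: "'a set \<Rightarrow> ('a \<Rightarrow> 'a \<Rightarrow> 'a) \<Rightarrow> 'a word set \<Rightarrow> 'a \<Rightarrow> 'a" where
  "env_theta Q op = presented_lift (Inn Q op) (left_translation Q op)"

definition Z0_group :: "'a set \<Rightarrow> ('a \<Rightarrow> 'a \<Rightarrow> 'a) \<Rightarrow> 'a word set monoid" where
  "Z0_group Q op =
     (env_group Q op)\<lparr>carrier := kernel (env_group Q op) (Inn Q op) (env_theta Q op)\<rparr>"

definition torsion :: "('a, 'b) monoid_scheme \<Rightarrow> 'a set" where
  "torsion G = {x \<in> carrier G. \<exists>n::nat. n > 0 \<and> x [^]\<^bsub>G\<^esub> n = \<one>\<^bsub>G\<^esub>}"

definition Tor_group :: "'a set \<Rightarrow> ('a \<Rightarrow> 'a \<Rightarrow> 'a) \<Rightarrow> 'a word set monoid" where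
  "Tor_group Q op = (Z0_group Q op)\<lparr>carrier := torsion (Z0_group Q op)\<rparr>"

definition Z0_mod_Tor :: "'a set \<Rightarrow> ('a \<Rightarrow> 'a \<Rightarrow> 'a) \<Rightarrow> 'a word set set monoid" where
  "Z0_mod_Tor Q op = Z0_group Q op Mod torsion (Z0_group Q op)"

text \<open>For an isomorphism \<open>\<alpha>\<close> from the direct sum of \<open>Tor(Z\<^sub>0)\<close> and \<open>Z\<^sub>0/Tor(Z\<^sub>0)\<close> to \<open>Z\<^sub>0\<close>,
  the following is the image under \<open>\<alpha>\<close> of the second summand.\<close>

definition free_part ::
  "'a set \<Rightarrow> ('a \<Rightarrow> 'a \<Rightarrow> 'a) \<Rightarrow> ('a word set \<times> 'a word set set \<Rightarrow> 'a word set) \<Rightarrow> 'a word set set" where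
  "free_part Q op \<alpha> = \<alpha> ` ({\<one>\<^bsub>Tor_group Q op\<^esub>} \<times> carrier (Z0_mod_Tor Q op))"

definition env_quotient ::
  "'a set \<Rightarrow> ('a \<Rightarrow> 'a \<Rightarrow> 'a) \<Rightarrow> ('a word set \<times> 'a word set set \<Rightarrow> 'a word set) \<Rightarrow> 'a word set set monoid" where
  "env_quotient Q op \<alpha> = env_group Q op Mod free_part Q op \<alpha>"

text \<open>The value on a coset \<open>C\<close> is the common value of \<open>\<theta>\<close> on the elements of \<open>C\<close>;
  see \<open>env_theta_bar_coset\<close> below.\<close>

definition env_theta_bar :: "'a set \<Rightarrow> ('a \<Rightarrow> 'a \<Rightarrow> 'a) \<Rightarrow> 'a word set set \<Rightarrow> 'a \<Rightarrow> 'a" where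
  "env_theta_bar Q op C = the_elem (env_theta Q op ` C)"

context quandle
begin

lemma left_translation_Bij: "x \<in> Q \<Longrightarrow> left_translation Q (\<triangleright>) x \<in> Bij Q"
proof -
  assume x: "x \<in> Q"
  have "bij_betw (left_translation Q (\<triangleright>) x) Q Q"
  proof (rule bij_betw_imageI)
    show "inj_on (left_translation Q (\<triangleright>) x) Q"
    proof (rule inj_onI)
      fix y z assume yz: "y \<in> Q" "z \<in> Q"
        and "left_translation Q (\<triangleright>) x y = left_translation Q (\<triangleright>) x z"
      then have "x \<triangleright> y = x \<triangleright> z" by (simp add: left_translation_def)
      with unique_solution[OF x op_closed[OF x yz(1)]] yz show "y = z" by metis
    qed
    show "left_translation Q (\<triangleright>) x ` Q = Q"
    proof (intro equalityI subsetI)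
      fix y assume "y \<in> left_translation Q (\<triangleright>) x ` Q"
      then show "y \<in> Q" using op_closed[OF x] by (auto simp: left_translation_def)
    next
      fix y assume "y \<in> Q"
      then obtain z where "z \<in> Q" "x \<triangleright> z = y" using unique_solution[OF x] by metis
      then show "y \<in> left_translation Q (\<triangleright>) x ` Q"
        by (intro image_eqI[of _ _ z]) (simp_all add: left_translation_def)
    qed
  qed
  then show ?thesis by (simp add: Bij_def left_translation_def)
qed

lemma subgroup_Inn:
  "subgroup (generate (BijGroup Q) (left_translation Q (\<triangleright>) ` Q)) (BijGroup Q)"
proof (rule group.generate_is_subgroup[OF group_BijGroup])
  show "left_translation Q (\<triangleright>) ` Q \<subseteq> carrier (BijGroup Q)"
    using left_translation_Bij by (auto simp: BijGroup_def)
qed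

lemma group_Inn: "group (Inn Q (\<triangleright>))"
  unfolding Inn_def by (rule subgroup.subgroup_is_group[OF subgroup_Inn group_BijGroup])

lemma left_translation_Inn: "x \<in> Q \<Longrightarrow> left_translation Q (\<triangleright>) x \<in> carrier (Inn Q (\<triangleright>))"
  by (auto simp: Inn_def intro: generate.incl)

lemma left_translation_mult:
  assumes "x \<in> Q" "y \<in> Q"
  shows "left_translation Q (\<triangleright>) x \<otimes>\<^bsub>Inn Q (\<triangleright>)\<^esub> left_translation Q (\<triangleright>) y
    = left_translation Q (\<triangleright>) (x \<triangleright> y) \<otimes>\<^bsub>Inn Q (\<triangleright>)\<^esub> left_translation Q (\<triangleright>) x"
proof -
  have "compose Q (left_translation Q (\<triangleright>) x) (left_translation Q (\<triangleright>) y)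
      = compose Q (left_translation Q (\<triangleright>) (x \<triangleright> y)) (left_translation Q (\<triangleright>) x)"
  proof
    fix z
    show "compose Q (left_translation Q (\<triangleright>) x) (left_translation Q (\<triangleright>) y) z
      = compose Q (left_translation Q (\<triangleright>) (x \<triangleright> y)) (left_translation Q (\<triangleright>) x) z"
      using self_distrib[OF assms, of z] assms
      by (cases "z \<in> Q") (simp_all add: compose_def left_translation_def op_closed)
  qed
  then show ?thesis
    using assms by (simp add: Inn_def BijGroup_def left_translation_Bij op_closed)
qed

lemma env_relations_respected:
  assumes "(u, v) \<in> env_relations Q (\<triangleright>)"
  shows "word_eval (Inn Q (\<triangleright>)) (left_translation Q (\<triangleright>)) u
    = word_eval (Inn Q (\<triangleright>)) (left_translation Q (\<triangleright>)) v"
proof -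
  interpret group "Inn Q (\<triangleright>)" by (rule group_Inn)
  obtain x y where xy: "x \<in> Q" "y \<in> Q"
    and u: "u = [(x, True), (y, True), (x, False)]" and v: "v = [(x \<triangleright> y, True)]"
    using assms by (auto simp: env_relations_def)
  note c = left_translation_Inn[OF xy(1)] left_translation_Inn[OF xy(2)]
    left_translation_Inn[OF op_closed[OF xy]]
  show ?thesis
    using c left_translation_mult[OF xy] inv_solve_right'[OF c(3)]
    unfolding u v by simp (metis inv_closed m_assoc m_closed r_inv r_one)
qed

lemma env_theta_hom: "env_theta Q (\<triangleright>) \<in> hom (env_group Q (\<triangleright>)) (Inn Q (\<triangleright>))"
  unfolding env_theta_def env_group_def
  by (rule presented_lift_hom[OF group_Inn])
     (auto simp: left_translation_Inn intro: env_relations_respected)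

lemma env_theta_generator:
  assumes "x \<in> Q"
  shows "env_theta Q (\<triangleright>) (generator Q (env_relations Q (\<triangleright>)) x) = left_translation Q (\<triangleright>) x"
  unfolding env_theta_def
  by (rule presented_lift_generator[OF group_Inn])
     (auto simp: left_translation_Inn assms intro: env_relations_respected)

lemma env_theta_bar_coset:
  assumes \<alpha>: "\<alpha> \<in> iso (Tor_group Q (\<triangleright>) \<times>\<times> Z0_mod_Tor Q (\<triangleright>)) (Z0_group Q (\<triangleright>))"
    and g: "g \<in> carrier (env_group Q (\<triangleright>))"
  shows "env_theta_bar Q (\<triangleright>) (free_part Q (\<triangleright>) \<alpha> #>\<^bsub>env_group Q (\<triangleright>)\<^esub> g) = env_theta Q (\<triangleright>) g"
proof -
  interpret E: group "env_group Q (\<triangleright>)"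
    unfolding env_group_def by (rule group_presented_group)
  interpret I: group "Inn Q (\<triangleright>)" by (rule group_Inn)
  interpret T: group_hom "env_group Q (\<triangleright>)" "Inn Q (\<triangleright>)" "env_theta Q (\<triangleright>)"
    by unfold_locales (rule env_theta_hom)
  interpret K: group "Z0_group Q (\<triangleright>)"
    unfolding Z0_group_def
    by (rule subgroup.subgroup_is_group[OF T.subgroup_kernel]) (rule E.is_group)
  have "\<one>\<^bsub>Tor_group Q (\<triangleright>)\<^esub> \<in> carrier (Tor_group Q (\<triangleright>))"
    by (auto simp: Tor_group_def torsion_def intro!: exI[of _ 1])
  then have sub: "free_part Q (\<triangleright>) \<alpha> \<subseteq> kernel (env_group Q (\<triangleright>)) (Inn Q (\<triangleright>)) (env_theta Q (\<triangleright>))"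
    using \<alpha> by (auto simp: free_part_def iso_def hom_def DirProd_def Z0_group_def Pi_iff)
  have "carrier (Z0_mod_Tor Q (\<triangleright>)) \<noteq> {}"
    using K.one_closed unfolding Z0_mod_Tor_def FactGroup_def RCOSETS_def by auto
  then have ne: "free_part Q (\<triangleright>) \<alpha> #>\<^bsub>env_group Q (\<triangleright>)\<^esub> g \<noteq> {}"
    by (auto simp: free_part_def r_coset_def)
  show ?thesis
    unfolding env_theta_bar_def
  proof (rule the_elem_image_unique[OF ne])
    fix h assume "h \<in> free_part Q (\<triangleright>) \<alpha> #>\<^bsub>env_group Q (\<triangleright>)\<^esub> g"
    then show "env_theta Q (\<triangleright>) h = env_theta Q (\<triangleright>) g"
      using sub g by (auto simp: r_coset_def kernel_def subset_iff)
  qed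
qed

end


section \<open>Stem extensions\<close>

definition center :: "('a, 'b) monoid_scheme \<Rightarrow> 'a set" where
  "center G = {z \<in> carrier G. \<forall>g\<in>carrier G. z \<otimes>\<^bsub>G\<^esub> g = g \<otimes>\<^bsub>G\<^esub> z}"

definition stem_extension ::
  "('a, 'c) monoid_scheme \<Rightarrow> ('b, 'd) monoid_scheme \<Rightarrow> ('a \<Rightarrow> 'b) \<Rightarrow> bool" where
  "stem_extension G H f \<longleftrightarrow>
     group G \<and> group H \<and> f \<in> epi G H \<and>
     kernel G H f \<subseteq> center G \<and> kernel G H f \<subseteq> derived G (carrier G)"

definition nucleus ::
  "('a, 'c) monoid_scheme \<Rightarrow> ('b, 'd) monoid_scheme \<Rightarrow> ('a \<Rightarrow> 'b) \<Rightarrow> ('a, 'c) monoid_scheme" where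
  "nucleus G H f = G\<lparr>carrier := kernel G H f\<rparr>"

end

theory Submission
  imports Defs "HOL-Algebra.Multiplicative_Group"
begin

text \<open>Write \<open>E\<close> for the enveloping group, \<open>Z\<^sub>0\<close> for the kernel of \<open>\<theta>\<close>, \<open>T\<close> for the torsion
  subgroup of \<open>Z\<^sub>0\<close> and \<open>F\<close> for the image under \<open>\<alpha>\<close> of the summand \<open>Z\<^sub>0/T\<close>.  An element \<open>g\<close> of \<open>E\<close>
  conjugates the generator \<open>y\<close> to the generator \<open>\<theta> g y\<close> (\<open>env_conj_gen\<close>), so \<open>Z\<^sub>0\<close> is central and
  \<open>F\<close> is normal in \<open>E\<close>.  Composing the inverse of \<open>\<alpha>\<close> with the first projection gives a split
  surjection from \<open>Z\<^sub>0\<close> to \<open>T\<close> with kernel \<open>F\<close>; hence the nucleus \<open>Z\<^sub>0/F\<close> of the induced extension is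
  isomorphic to \<open>T\<close>, and each of its elements is the coset of a torsion element of \<open>Z\<^sub>0\<close>.

  The nucleus lies in the derived subgroup because the abelianisation of \<open>E\<close> is torsion-free:
  a torsion element of \<open>E\<close> dies in every abelian image
  (\<open>hom_comm_group_torsion_trivial\<close>), in particular modulo the derived subgroup.

  The inner group is finite, so \<open>Z\<^sub>0\<close> is the kernel of a morphism with finite image on a finitely
  generated group.  By Schreier's lemma (\<open>finitely_generated_kernel\<close>) \<open>Z\<^sub>0\<close> is finitely generated,
  and so is its image \<open>T\<close> under that split surjection.  A finitely generated abelian torsion group is finite,
  so the quotient of \<open>E\<close> by \<open>F\<close> is an extension of a finite group by a finite group.\<close>


section \<open>Torsion in abelian groups\<close>

lemma (in comm_group) subgroup_torsion: "subgroup (torsion G) G"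
proof (rule subgroupI)
  show "torsion G \<noteq> {}"
    by (auto simp: torsion_def intro!: exI[of _ \<one>] exI[of _ "1::nat"])
next
  fix x assume "x \<in> torsion G"
  then show "inv x \<in> torsion G"
    by (auto simp: torsion_def nat_pow_inv)
next
  fix x y assume "x \<in> torsion G" "y \<in> torsion G"
  then obtain m n :: nat where mn: "m > 0" "n > 0" "x [^] m = \<one>" "y [^] n = \<one>"
    and xy: "x \<in> carrier G" "y \<in> carrier G"
    by (auto simp: torsion_def)
  have "(x \<otimes> y) [^] (m * n) = x [^] (m * n) \<otimes> y [^] (n * m)"
    using xy by (simp add: pow_mult_distrib m_comm mult.commute)
  also have "\<dots> = \<one>"
    using xy mn by (simp flip: nat_pow_pow)
  finally show "x \<otimes> y \<in> torsion G"
    using xy mn by (auto simp: torsion_def intro!: exI[of _ "m * n"])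
qed (auto simp: torsion_def)

lemma (in comm_group) finite_generate_torsion:
  assumes "finite Y" and "Y \<subseteq> torsion G"
  shows "finite (generate G Y)"
  using assms
proof (induction Y rule: finite_induct)
  case empty
  then show ?case by (simp add: generate_empty)
next
  case (insert y Y)
  have Y: "Y \<subseteq> carrier G" and y: "y \<in> carrier G"
    using insert.prems by (auto simp: torsion_def)
  have "finite (generate G {y})"
    using finite_cyclic_subgroup[OF y] insert.prems y
    by (auto simp: torsion_def subgroup_generated_def)
  then have fin: "finite (generate G {y} <#> generate G Y)"
    using insert by (auto simp: set_mult_def)
  have sub: "subgroup (generate G {y} <#> generate G Y) G"
    using Y y by (intro mult_subgroups generate_is_subgroup) auto
  have "insert y Y \<subseteq> generate G {y} <#> generate G Y"
  proof
    fix z assume z: "z \<in> insert y Y"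
    then have "z = z \<otimes> \<one>" "z = \<one> \<otimes> z" using Y y by auto
    with z show "z \<in> generate G {y} <#> generate G Y"
      unfolding set_mult_def by (blast intro: generate.one generate.incl)
  qed
  with sub have "generate G (insert y Y) \<subseteq> generate G {y} <#> generate G Y"
    by (rule generate_subgroup_incl[rotated])
  then show ?case using fin by (rule finite_subset)
qed


section \<open>Generation and kernels\<close>

lemma hom_eq_on_generate:
  assumes "group_hom G H f" and "group_hom G H k" and S: "S \<subseteq> carrier G"
    and eq: "\<And>x. x \<in> S \<Longrightarrow> f x = k x" and g: "g \<in> generate G S"
  shows "f g = k g"
proof -
  interpret f: group_hom G H f by fact
  interpret k: group_hom G H k by fact
  have "g \<in> carrier G \<and> f g = k g"
    using g by (induction rule: generate.induct) (use S eq in auto)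
  then show ?thesis by simp
qed

text \<open>Schreier's lemma for a normal subgroup of finite index, presented as the kernel of a morphism
  with finite image: the Schreier generators attached to a section of the morphism generate the
  kernel.\<close>

lemma (in group_hom) finitely_generated_kernel:
  assumes S: "finite S" "S \<subseteq> carrier G" "generate G S = carrier G"
    and fin: "finite (h ` carrier G)"
  shows "\<exists>Y. finite Y \<and> Y \<subseteq> carrier G \<and> generate G Y = kernel G H h"
proof -
  \<comment> \<open>A section of the morphism, normalised to send the unit to the unit, so that the
    rewriting of a kernel element below starts and ends at the unit.\<close>
  define t where "t c = (if c = \<one>\<^bsub>H\<^esub> then \<one> else inv_into (carrier G) h c)" for c
  have t: "t c \<in> carrier G" "h (t c) = c" if "c \<in> h ` carrier G" for c
    using that by (auto simp: t_def inv_into_into f_inv_into_f)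
  have tc: "t (h a) \<in> carrier G" "h (t (h a)) = h a" if "a \<in> carrier G" for a
    using that t by auto
  define y where "y a x = t (h a) \<otimes> x \<otimes> inv (t (h a \<otimes>\<^bsub>H\<^esub> h x))" for a x
  define Y where "Y = (\<lambda>(c, x). t c \<otimes> x \<otimes> inv (t (c \<otimes>\<^bsub>H\<^esub> h x))) ` (h ` carrier G \<times> S)"
  have yk: "y a x \<in> kernel G H h" if "a \<in> carrier G" "x \<in> carrier G" for a x
    using tc[of a] tc[of "a \<otimes> x"] that by (auto simp: y_def kernel_def)
  have Ysub: "Y \<subseteq> kernel G H h"
    using yk S(2) by (auto simp: Y_def y_def)
  then have Yc: "Y \<subseteq> carrier G" by (auto simp: kernel_def)
  \<comment> \<open>The base point must vary: rewriting a product changes the coset from which its second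
    factor is read.\<close>
  have rep: "g \<in> carrier G \<and> (\<forall>a\<in>carrier G. y a g \<in> generate G Y)" if "g \<in> generate G S" for g
    using that
  proof (induction rule: generate.induct)
    case one
    then show ?case using tc by (auto simp: y_def intro: generate.one)
  next
    case (incl x)
    then show ?case using S(2) by (auto simp: y_def Y_def intro!: generate.incl)
  next
    case (inv x)
    then have x: "x \<in> carrier G" using S(2) by auto
    \<comment> \<open>An edge of the coset graph read backwards contributes the inverse of its Schreier generator.\<close>
    have "y a (inv x) = inv (y (a \<otimes> inv x) x)" if a: "a \<in> carrier G" for a
    proof -
      have "h (a \<otimes> inv x) \<otimes>\<^bsub>H\<^esub> h x = h a"
        using a x by (simp add: H.m_assoc)
      then show ?thesis
        using a x tc[of a] tc[of "a \<otimes> inv x"] by (simp add: y_def G.inv_mult_group G.m_assoc)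
    qed
    moreover have "y (a \<otimes> inv x) x \<in> Y" if "a \<in> carrier G" for a
      using that x inv
      by (auto simp: y_def Y_def simp flip: hom_mult hom_inv
          intro!: image_eqI[of _ _ "(h (a \<otimes> inv x), x)"])
    ultimately show ?case using x by (auto intro: generate.inv)
  next
    case (eng g k)
    have "y a (g \<otimes> k) = y a g \<otimes> y (a \<otimes> g) k" if a: "a \<in> carrier G" for a
    proof -
      have "inv t (h a \<otimes>\<^bsub>H\<^esub> h g) \<otimes> (t (h a \<otimes>\<^bsub>H\<^esub> h g) \<otimes> w) = w" if "w \<in> carrier G" for w
        using tc[of "a \<otimes> g"] a eng.IH that by (simp flip: G.m_assoc)
      then show ?thesis
        using a eng.IH tc[of a] tc[of "a \<otimes> g"] tc[of "a \<otimes> (g \<otimes> k)"]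
        by (simp add: y_def G.m_assoc H.m_assoc)
    qed
    then show ?case using eng.IH by (auto intro: generate.eng)
  qed
  have "generate G Y = kernel G H h"
  proof
    show "generate G Y \<subseteq> kernel G H h"
      using Ysub subgroup_kernel by (rule G.generate_subgroup_incl)
    show "kernel G H h \<subseteq> generate G Y"
    proof
      fix g assume g: "g \<in> kernel G H h"
      then have "g \<in> carrier G" by (simp add: kernel_def)
      moreover from this have "y \<one> g \<in> generate G Y" using rep[of g] S(3) by auto
      ultimately show "g \<in> generate G Y"
        using g by (simp add: y_def kernel_def t_def)
    qed
  qed
  moreover have "finite Y" using S(1) fin by (simp add: Y_def)
  ultimately show ?thesis using Yc by blast
qed

lemma (in group_hom) finite_carrier_if_finite_kernel_image:
  assumes "finite (kernel G H h)" and "finite (h ` carrier G)"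
  shows "finite (carrier G)"
proof -
  have "finite {g \<in> carrier G. h g = h a}" if a: "a \<in> carrier G" for a
  proof (rule finite_subset)
    show "{g \<in> carrier G. h g = h a} \<subseteq> (\<lambda>k. k \<otimes> a) ` kernel G H h"
    proof
      fix g assume g: "g \<in> {g \<in> carrier G. h g = h a}"
      then have "(g \<otimes> inv a) \<otimes> a = g" "g \<otimes> inv a \<in> kernel G H h"
        using a by (auto simp: G.m_assoc kernel_def)
      then show "g \<in> (\<lambda>k. k \<otimes> a) ` kernel G H h" by (metis imageI)
    qed
  qed (use assms in simp)
  then have "finite (\<Union>c\<in>h ` carrier G. {g \<in> carrier G. h g = c})"
    using assms by (intro finite_UN_I) auto
  moreover have "carrier G \<subseteq> (\<Union>c\<in>h ` carrier G. {g \<in> carrier G. h g = c})" by auto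
  ultimately show ?thesis by (rule finite_subset[rotated])
qed


section \<open>Generators of a presented group\<close>

lemma generator_closed: "x \<in> X \<Longrightarrow> generator X R x \<in> carrier (presented_group X R)"
  by (simp add: generator_def presented_carrierI)

lemma inv_generator:
  assumes "x \<in> X"
  shows "inv\<^bsub>presented_group X R\<^esub> (generator X R x) = word_cong X R `` {[(x, False)]}"
proof (rule group.inv_equality[OF group_presented_group])
  show "(word_cong X R `` {[(x, False)]}) \<otimes>\<^bsub>presented_group X R\<^esub> generator X R x
      = \<one>\<^bsub>presented_group X R\<^esub>"
    using assms equiv_class_eq[OF equiv_word_cong word_cong.cancel[OF assms, of False R]]
    by (simp add: generator_def presented_mult_class presented_one)
qed (use assms in \<open>auto simp: generator_closed presented_carrierI\<close>)

lemma presented_group_generate: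
  "generate (presented_group X R) (generator X R ` X) = carrier (presented_group X R)"
proof
  interpret P: group "presented_group X R" by (rule group_presented_group)
  show "generate (presented_group X R) (generator X R ` X) \<subseteq> carrier (presented_group X R)"
    by (rule P.generate_incl) (auto simp: generator_closed)
  have "word_cong X R `` {u} \<in> generate (presented_group X R) (generator X R ` X)"
    if "u \<in> words X" for u
    using that
  proof (induction u)
    case Nil
    then show ?case by (simp flip: presented_one add: generate.one)
  next
    case (Cons a u)
    obtain x b where a: "a = (x, b)" by force
    have x: "x \<in> X" and u: "u \<in> words X" using Cons.prems a by auto
    have "word_cong X R `` {[a]} \<in> generate (presented_group X R) (generator X R ` X)"
    proof (cases b)
      case True
      then show ?thesis
        using x a generate.incl[of "generator X R x" "generator X R ` X" "presented_group X R"]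
        by (simp add: generator_def)
    next
      case False
      then show ?thesis
        using x a generate.inv[of "generator X R x" "generator X R ` X" "presented_group X R"]
        by (simp add: inv_generator)
    qed
    from generate.eng[OF this Cons.IH[OF u]] show ?case
      using x u a by (simp add: presented_mult_class)
  qed
  then show "carrier (presented_group X R) \<subseteq> generate (presented_group X R) (generator X R ` X)"
    by (auto elim: presented_carrierE)
qed


section \<open>The enveloping group\<close>

context quandle
begin

abbreviation "E \<equiv> env_group Q (\<triangleright>)"
abbreviation "\<theta> \<equiv> env_theta Q (\<triangleright>)"
abbreviation "gen \<equiv> generator Q (env_relations Q (\<triangleright>))"

lemma group_env: "group E"
  unfolding env_group_def by (rule group_presented_group)

lemma env_theta_group_hom: "group_hom E (Inn Q (\<triangleright>)) \<theta>"
  by (simp add: group_hom_def group_hom_axioms_def group_env group_Inn env_theta_hom)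

lemma gen_closed: "x \<in> Q \<Longrightarrow> gen x \<in> carrier E"
  by (simp add: env_group_def generator_closed)

lemma env_generate: "generate E (gen ` Q) = carrier E"
  by (simp add: env_group_def presented_group_generate)

lemma gen_conj:
  assumes "x \<in> Q" "y \<in> Q"
  shows "gen x \<otimes>\<^bsub>E\<^esub> gen y \<otimes>\<^bsub>E\<^esub> inv\<^bsub>E\<^esub> (gen x) = gen (x \<triangleright> y)"
proof -
  let ?u = "[(x, True), (y, True), (x, False)]"
  have "(?u, [(x \<triangleright> y, True)]) \<in> word_cong Q (env_relations Q (\<triangleright>))"
    by (rule word_cong.rel) (use assms op_closed in \<open>auto simp: env_relations_def\<close>)
  from equiv_class_eq[OF equiv_word_cong this] show ?thesis
    using assms unfolding env_group_def
    by (simp add: inv_generator) (simp add: generator_def presented_mult_class)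
qed

lemma carrier_Inn_Bij: "\<phi> \<in> carrier (Inn Q (\<triangleright>)) \<Longrightarrow> \<phi> \<in> Bij Q"
  using subgroup.subset[OF subgroup_Inn] by (auto simp: Inn_def BijGroup_def)

lemma carrier_Inn_closed: "\<phi> \<in> carrier (Inn Q (\<triangleright>)) \<Longrightarrow> y \<in> Q \<Longrightarrow> \<phi> y \<in> Q"
  using carrier_Inn_Bij Bij_imp_funcset by blast

lemma mult_Inn_apply:
  assumes "\<phi> \<in> carrier (Inn Q (\<triangleright>))" "\<psi> \<in> carrier (Inn Q (\<triangleright>))" "y \<in> Q"
  shows "(\<phi> \<otimes>\<^bsub>Inn Q (\<triangleright>)\<^esub> \<psi>) y = \<phi> (\<psi> y)"
  using assms(1,2)[THEN carrier_Inn_Bij] assms(3)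
  by (simp add: Inn_def BijGroup_def compose_def)

lemma one_Inn_apply: "y \<in> Q \<Longrightarrow> \<one>\<^bsub>Inn Q (\<triangleright>)\<^esub> y = y"
  by (simp add: Inn_def BijGroup_def)

lemma finite_Inn:
  assumes "finite Q"
  shows "finite (carrier (Inn Q (\<triangleright>)))"
proof (rule finite_subset)
  show "carrier (Inn Q (\<triangleright>)) \<subseteq> Q \<rightarrow>\<^sub>E Q"
  proof
    fix \<phi> assume "\<phi> \<in> carrier (Inn Q (\<triangleright>))"
    then have "\<phi> \<in> Bij Q" by (rule carrier_Inn_Bij)
    then show "\<phi> \<in> Q \<rightarrow>\<^sub>E Q" by (auto simp: PiE_def Bij_def bij_betw_def)
  qed
  show "finite (Q \<rightarrow>\<^sub>E Q)" using assms by (intro finite_PiE) auto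
qed

text \<open>The defining relations say that generators conjugate one another as the left translations
  permute them; hence every element conjugates the generators through its image in the inner
  group.\<close>

lemma env_conj_gen:
  assumes "g \<in> carrier E" "y \<in> Q"
  shows "g \<otimes>\<^bsub>E\<^esub> gen y = gen (\<theta> g y) \<otimes>\<^bsub>E\<^esub> g"
proof -
  interpret T: group_hom E "Inn Q (\<triangleright>)" \<theta> by (rule env_theta_group_hom)
  have "g \<in> carrier E \<and> (\<forall>y\<in>Q. g \<otimes>\<^bsub>E\<^esub> gen y = gen (\<theta> g y) \<otimes>\<^bsub>E\<^esub> g)" if "g \<in> generate E (gen ` Q)"
    using that
  proof (induction rule: generate.induct)
    case one
    then show ?case by (simp add: one_Inn_apply gen_closed)
  next
    case (incl g)
    then obtain x where x: "x \<in> Q" and g: "g = gen x" by auto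
    have "gen x \<otimes>\<^bsub>E\<^esub> gen y = gen (x \<triangleright> y) \<otimes>\<^bsub>E\<^esub> gen x" if y: "y \<in> Q" for y
      using x y by (simp add: gen_closed T.G.m_assoc flip: gen_conj)
    then show ?case using x g by (simp add: gen_closed env_theta_generator left_translation_def)
  next
    case (inv g)
    then obtain x where x: "x \<in> Q" and g: "g = gen x" by auto
    have "inv\<^bsub>E\<^esub> gen x \<otimes>\<^bsub>E\<^esub> gen y = gen (\<theta> (inv\<^bsub>E\<^esub> gen x) y) \<otimes>\<^bsub>E\<^esub> inv\<^bsub>E\<^esub> gen x" if y: "y \<in> Q" for y
    proof -
      define z where "z = \<theta> (inv\<^bsub>E\<^esub> gen x) y"
      have z: "z \<in> Q"
        using carrier_Inn_closed x y by (simp add: z_def gen_closed del: T.hom_inv)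
      have "x \<triangleright> z = \<theta> (gen x) z"
        using x z by (simp add: env_theta_generator left_translation_def)
      also have "\<dots> = (\<theta> (gen x) \<otimes>\<^bsub>Inn Q (\<triangleright>)\<^esub> \<theta> (inv\<^bsub>E\<^esub> gen x)) y"
        using x y by (simp add: mult_Inn_apply gen_closed z_def del: T.hom_inv)
      also have "\<dots> = y"
        using x y by (simp add: gen_closed one_Inn_apply)
      finally have "gen x \<otimes>\<^bsub>E\<^esub> gen z \<otimes>\<^bsub>E\<^esub> inv\<^bsub>E\<^esub> gen x = gen y"
        using gen_conj[OF x z] by simp
      then have "inv\<^bsub>E\<^esub> gen x \<otimes>\<^bsub>E\<^esub> gen y
          = inv\<^bsub>E\<^esub> gen x \<otimes>\<^bsub>E\<^esub> (gen x \<otimes>\<^bsub>E\<^esub> (gen z \<otimes>\<^bsub>E\<^esub> inv\<^bsub>E\<^esub> gen x))"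
        using x z by (simp add: gen_closed T.G.m_assoc)
      also have "\<dots> = gen z \<otimes>\<^bsub>E\<^esub> inv\<^bsub>E\<^esub> gen x"
        using x z by (simp add: gen_closed flip: T.G.m_assoc)
      finally show ?thesis by (simp add: z_def)
    qed
    then show ?case using x g by (simp add: gen_closed)
  next
    case (eng g k)
    have "g \<otimes>\<^bsub>E\<^esub> k \<otimes>\<^bsub>E\<^esub> gen y = gen (\<theta> (g \<otimes>\<^bsub>E\<^esub> k) y) \<otimes>\<^bsub>E\<^esub> (g \<otimes>\<^bsub>E\<^esub> k)" if y: "y \<in> Q" for y
    proof -
      have ky: "\<theta> k y \<in> Q" and gky: "\<theta> g (\<theta> k y) \<in> Q"
        using eng.IH y carrier_Inn_closed by auto
      have "g \<otimes>\<^bsub>E\<^esub> k \<otimes>\<^bsub>E\<^esub> gen y = g \<otimes>\<^bsub>E\<^esub> (gen (\<theta> k y) \<otimes>\<^bsub>E\<^esub> k)"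
        using eng.IH y by (simp add: T.G.m_assoc gen_closed)
      also have "\<dots> = gen (\<theta> g (\<theta> k y)) \<otimes>\<^bsub>E\<^esub> g \<otimes>\<^bsub>E\<^esub> k"
        using eng.IH ky by (simp add: gen_closed flip: T.G.m_assoc)
      also have "\<dots> = gen (\<theta> g (\<theta> k y)) \<otimes>\<^bsub>E\<^esub> (g \<otimes>\<^bsub>E\<^esub> k)"
        using eng.IH ky gky by (simp add: T.G.m_assoc gen_closed)
      finally show ?thesis using eng.IH y by (simp add: mult_Inn_apply)
    qed
    then show ?case using eng.IH by simp
  qed
  with assms show ?thesis by (simp add: env_generate)
qed

lemma env_theta_kernel_central: "kernel E (Inn Q (\<triangleright>)) \<theta> \<subseteq> center E"
proof
  interpret T: group_hom E "Inn Q (\<triangleright>)" \<theta> by (rule env_theta_group_hom)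
  fix z assume "z \<in> kernel E (Inn Q (\<triangleright>)) \<theta>"
  then have z: "z \<in> carrier E" "\<theta> z = \<one>\<^bsub>Inn Q (\<triangleright>)\<^esub>" by (auto simp: kernel_def)
  have gz: "z \<otimes>\<^bsub>E\<^esub> gen y = gen y \<otimes>\<^bsub>E\<^esub> z" if "y \<in> Q" for y
    using env_conj_gen[OF z(1) that] z(2) that by (simp add: one_Inn_apply)
  have "g \<in> carrier E \<and> z \<otimes>\<^bsub>E\<^esub> g = g \<otimes>\<^bsub>E\<^esub> z" if "g \<in> generate E (gen ` Q)" for g
    using that
  proof (induction rule: generate.induct)
    case one
    then show ?case using z by simp
  next
    case (incl g)
    then show ?case using gz by (auto simp: gen_closed)
  next
    case (inv g)
    then obtain x where x: "x \<in> Q" and g: "g = gen x" by auto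
    have "z \<otimes>\<^bsub>E\<^esub> inv\<^bsub>E\<^esub> gen x = inv\<^bsub>E\<^esub> gen x \<otimes>\<^bsub>E\<^esub> (gen x \<otimes>\<^bsub>E\<^esub> z) \<otimes>\<^bsub>E\<^esub> inv\<^bsub>E\<^esub> gen x"
      using x z by (simp add: gen_closed flip: T.G.m_assoc)
    also have "\<dots> = inv\<^bsub>E\<^esub> gen x \<otimes>\<^bsub>E\<^esub> z"
      using x z by (simp add: gen_closed T.G.m_assoc flip: gz)
    finally show ?case using x g by (simp add: gen_closed)
  next
    case (eng g k)
    have "z \<otimes>\<^bsub>E\<^esub> (g \<otimes>\<^bsub>E\<^esub> k) = z \<otimes>\<^bsub>E\<^esub> g \<otimes>\<^bsub>E\<^esub> k"
      using z eng.IH by (simp flip: T.G.m_assoc)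
    also have "\<dots> = g \<otimes>\<^bsub>E\<^esub> k \<otimes>\<^bsub>E\<^esub> z"
      using z eng.IH by (simp add: T.G.m_assoc)
    finally show ?case using eng.IH by simp
  qed
  then show "z \<in> center E" using z by (simp add: center_def env_generate)
qed

text \<open>The abelianisation of the enveloping group is free on the orbits of the quandle, hence
  torsion-free.  The consequence needed here is obtained without orbits.  Fix a morphism to an abelian
  group.  For each value it takes on the generators, counting with sign the letters with that
  value is a morphism to the integers, because the defining relations preserve the value.  The image
  of an element is the product of these values raised to the counts, and the counts vanish on
  torsion elements.\<close>

lemma hom_comm_group_torsion_trivial:
  assumes fin: "finite Q" and A: "comm_group A" and \<pi>: "\<pi> \<in> hom E A"
    and z: "z \<in> carrier E" "z [^]\<^bsub>E\<^esub> n = \<one>\<^bsub>E\<^esub>" "n > (0::nat)"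
  shows "\<pi> z = \<one>\<^bsub>A\<^esub>"
proof -
  interpret A: comm_group A by (rule A)
  interpret E: group E by (rule group_env)
  interpret P: group_hom E A \<pi> by unfold_locales (rule \<pi>)
  define a where "a x = \<pi> (gen x)" for x
  have a: "a x \<in> carrier A" if "x \<in> Q" for x using that by (simp add: a_def gen_closed)
  have a_op: "a (x \<triangleright> y) = a y" if "x \<in> Q" "y \<in> Q" for x y
  proof -
    have "a (x \<triangleright> y) = a x \<otimes>\<^bsub>A\<^esub> a y \<otimes>\<^bsub>A\<^esub> inv\<^bsub>A\<^esub> a x"
      using that by (simp add: a_def gen_closed flip: gen_conj)
    also have "\<dots> = a y"
      using a that by (simp add: A.m_comm[of "a x"] A.m_assoc)
    finally show ?thesis .
  qed
  \<comment> \<open>The signed number of letters with value s.\<close>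
  define \<phi> where "\<phi> s = presented_lift integer_group (\<lambda>x. if a x = s then 1 else 0)" for s
  have resp: "word_eval integer_group (\<lambda>x. if a x = s then 1 else 0) u
      = word_eval integer_group (\<lambda>x. if a x = s then 1 else 0) v"
    if "(u, v) \<in> env_relations Q (\<triangleright>)" for u v s
    using that by (auto simp: env_relations_def a_op)
  have \<phi>: "\<phi> s \<in> hom E integer_group" for s
    unfolding \<phi>_def env_group_def by (rule presented_lift_hom) (auto intro: resp)
  have \<phi>_gen: "\<phi> s (gen x) = (if a x = s then 1 else 0)" if "x \<in> Q" for s x
    unfolding \<phi>_def using that
    by (intro presented_lift_generator[where f = "\<lambda>x. if a x = s then 1 else 0"])
      (auto intro: resp)
  define \<psi> where "\<psi> g = (\<Otimes>\<^bsub>A\<^esub>s\<in>a ` Q. s [^]\<^bsub>A\<^esub> \<phi> s g)" for g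
  have "\<psi> \<in> hom E A"
  proof (rule homI)
    fix g k assume gk: "g \<in> carrier E" "k \<in> carrier E"
    have "s [^]\<^bsub>A\<^esub> \<phi> s (g \<otimes>\<^bsub>E\<^esub> k) = s [^]\<^bsub>A\<^esub> \<phi> s g \<otimes>\<^bsub>A\<^esub> s [^]\<^bsub>A\<^esub> \<phi> s k" if "s \<in> a ` Q" for s
      using hom_mult[OF \<phi> gk] a that by (auto simp: A.int_pow_mult)
    then have "\<psi> (g \<otimes>\<^bsub>E\<^esub> k)
        = (\<Otimes>\<^bsub>A\<^esub>s\<in>a ` Q. s [^]\<^bsub>A\<^esub> \<phi> s g \<otimes>\<^bsub>A\<^esub> s [^]\<^bsub>A\<^esub> \<phi> s k)"
      unfolding \<psi>_def using a by (intro A.finprod_cong') auto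
    then show "\<psi> (g \<otimes>\<^bsub>E\<^esub> k) = \<psi> g \<otimes>\<^bsub>A\<^esub> \<psi> k"
      unfolding \<psi>_def using a by (simp add: A.finprod_multf Pi_iff)
  qed (use a in \<open>auto simp: \<psi>_def intro!: A.finprod_closed\<close>)
  then have \<psi>: "group_hom E A \<psi>" by unfold_locales
  have \<psi>_gen: "\<psi> (gen x) = \<pi> (gen x)" if x: "x \<in> Q" for x
  proof -
    have "\<psi> (gen x) = (\<Otimes>\<^bsub>A\<^esub>s\<in>a ` Q. if a x = s then s else \<one>\<^bsub>A\<^esub>)"
      unfolding \<psi>_def using a x by (intro A.finprod_cong') (auto simp: \<phi>_gen)
    also have "\<dots> = a x"
      using A.finprod_singleton[of "a x" "a ` Q" "\<lambda>s. s"] x a fin by auto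
    finally show ?thesis by (simp add: a_def)
  qed
  have "\<pi> z = \<psi> z"
  proof (rule hom_eq_on_generate[OF P.group_hom_axioms \<psi>, of "gen ` Q", rotated 2])
    show "z \<in> generate E (gen ` Q)" using z(1) by (simp add: env_generate)
  qed (auto simp: gen_closed \<psi>_gen)
  moreover have "\<phi> s z = 0" for s
  proof -
    interpret F: group_hom E integer_group "\<phi> s"
      by (simp add: group_hom_def group_hom_axioms_def group_env \<phi>)
    have "\<phi> s z [^]\<^bsub>integer_group\<^esub> n = \<phi> s (z [^]\<^bsub>E\<^esub> n)"
      using z(1) by (rule F.hom_nat_pow[symmetric])
    also have "\<dots> = 0" unfolding z(2) F.hom_one by simp
    finally have "int n * \<phi> s z = 0" by (simp only: group_nat_pow_integer_group)
    then show ?thesis using z by simp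
  qed
  ultimately show ?thesis using a by (simp add: \<psi>_def A.finprod_one_eqI)
qed

lemma torsion_in_derived:
  assumes "finite Q" and z: "z \<in> carrier E" "z [^]\<^bsub>E\<^esub> n = \<one>\<^bsub>E\<^esub>" "n > (0::nat)"
  shows "z \<in> derived E (carrier E)"
proof -
  interpret E: group E by (rule group_env)
  interpret D: normal "derived E (carrier E)" E by (rule E.derived_self_is_normal)
  have "derived E (carrier E) #>\<^bsub>E\<^esub> z = \<one>\<^bsub>E Mod derived E (carrier E)\<^esub>"
    using hom_comm_group_torsion_trivial[OF assms(1) E.derived_quot_is_comm_group
        D.r_coset_hom_Mod z] .
  then show ?thesis
    using E.rcos_self[OF z(1) D.subgroup_axioms] by (simp add: FactGroup_def)
qed

lemma env_theta_surj: "\<theta> ` carrier E = carrier (Inn Q (\<triangleright>))"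
proof -
  interpret T: group_hom E "Inn Q (\<triangleright>)" \<theta> by (rule env_theta_group_hom)
  have "\<theta> ` carrier E = generate (Inn Q (\<triangleright>)) (\<theta> ` gen ` Q)"
    using T.generate_img[of "gen ` Q"] by (simp add: env_generate gen_closed image_subsetI)
  also have "\<theta> ` gen ` Q = left_translation Q (\<triangleright>) ` Q"
    by (auto simp: env_theta_generator image_iff)
  also have "generate (Inn Q (\<triangleright>)) (left_translation Q (\<triangleright>) ` Q) = carrier (Inn Q (\<triangleright>))"
    unfolding Inn_def
    by (simp add: group.generate_consistent[OF group_BijGroup _ subgroup_Inn] subsetI generate.incl)
  finally show ?thesis .
qed

lemma carrier_Z0_group [simp]: "carrier (Z0_group Q (\<triangleright>)) = kernel E (Inn Q (\<triangleright>)) \<theta>"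
  and mult_Z0_group [simp]: "x \<otimes>\<^bsub>Z0_group Q (\<triangleright>)\<^esub> y = x \<otimes>\<^bsub>E\<^esub> y"
  and one_Z0_group [simp]: "\<one>\<^bsub>Z0_group Q (\<triangleright>)\<^esub> = \<one>\<^bsub>E\<^esub>"
  by (simp_all add: Z0_group_def)

lemma comm_group_Z0: "comm_group (Z0_group Q (\<triangleright>))"
proof -
  interpret T: group_hom E "Inn Q (\<triangleright>)" \<theta> by (rule env_theta_group_hom)
  have "group (Z0_group Q (\<triangleright>))"
    unfolding Z0_group_def by (rule T.G.subgroup_imp_group[OF T.subgroup_kernel])
  then show ?thesis
    by (rule group.group_comm_groupI)
      (use env_theta_kernel_central in \<open>auto simp: center_def kernel_def\<close>)
qed

lemma comm_group_Tor: "comm_group (Tor_group Q (\<triangleright>))"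
proof -
  interpret Z: comm_group "Z0_group Q (\<triangleright>)" by (rule comm_group_Z0)
  have "group (Tor_group Q (\<triangleright>))"
    unfolding Tor_group_def by (rule Z.subgroup_imp_group[OF Z.subgroup_torsion])
  then show ?thesis
    by (rule group.group_comm_groupI) (use Z.m_comm in \<open>auto simp: Tor_group_def torsion_def\<close>)
qed

lemma group_Z0_mod_Tor: "group (Z0_mod_Tor Q (\<triangleright>))"
  unfolding Z0_mod_Tor_def
  by (rule normal.factorgroup_is_group)
    (rule comm_group.subgroup_imp_normal[OF comm_group_Z0 comm_group.subgroup_torsion[OF comm_group_Z0]])

lemma pow_Z0_group: "x [^]\<^bsub>Z0_group Q (\<triangleright>)\<^esub> (n::nat) = x [^]\<^bsub>E\<^esub> n"
  by (simp add: nat_pow_def Z0_group_def)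

end


section \<open>The quotient by the free part\<close>

text \<open>A quandle with a chosen isomorphism from the direct sum of \<open>Tor(Z\<^sub>0)\<close> and \<open>Z\<^sub>0/Tor(Z\<^sub>0)\<close> to \<open>Z\<^sub>0\<close>.
  The isomorphism is not required to restrict to the inclusion on the first summand.\<close>

locale quandle_splitting = quandle +
  fixes \<alpha>
  assumes \<alpha>: "\<alpha> \<in> iso (Tor_group Q (\<triangleright>) \<times>\<times> Z0_mod_Tor Q (\<triangleright>)) (Z0_group Q (\<triangleright>))"
begin

abbreviation "Z \<equiv> Z0_group Q (\<triangleright>)"
abbreviation "T \<equiv> Tor_group Q (\<triangleright>)"
abbreviation "M \<equiv> Z0_mod_Tor Q (\<triangleright>)"
abbreviation "F \<equiv> free_part Q (\<triangleright>) \<alpha>"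
abbreviation "E\<^sub>\<alpha> \<equiv> env_quotient Q (\<triangleright>) \<alpha>"
abbreviation "\<theta>' \<equiv> env_theta_bar Q (\<triangleright>)"

sublocale Th: group_hom E "Inn Q (\<triangleright>)" \<theta> by (rule env_theta_group_hom)
sublocale Z: comm_group Z by (rule comm_group_Z0)
sublocale T: comm_group T by (rule comm_group_Tor)
sublocale M: group M by (rule group_Z0_mod_Tor)
sublocale A: group_hom "T \<times>\<times> M" Z \<alpha>
  using \<alpha> by (simp add: group_hom_def group_hom_axioms_def DirProd_group iso_def)

text \<open>The first coordinate of an element of \<open>Z\<^sub>0\<close> in the decomposition given by \<open>\<alpha>\<close>.\<close>

definition proj where "proj z = fst (inv_into (carrier (T \<times>\<times> M)) \<alpha> z)"
text \<open>The embedding of the torsion summand that splits \<open>proj\<close>; it is induced by \<open>\<alpha>\<close> and need not be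
  the inclusion of \<open>Tor(Z\<^sub>0)\<close> in \<open>Z\<^sub>0\<close>.\<close>

definition sec where "sec t = \<alpha> (t, \<one>\<^bsub>M\<^esub>)"

lemma proj_hom: "group_hom Z T proj"
proof -
  have "inv_into (carrier (T \<times>\<times> M)) \<alpha> \<in> hom Z (T \<times>\<times> M)"
    using group.iso_set_sym[OF A.G.is_group \<alpha>] by (simp add: iso_def)
  moreover have "fst \<in> hom (T \<times>\<times> M) T" by (auto simp: hom_def)
  ultimately have "fst \<circ> inv_into (carrier (T \<times>\<times> M)) \<alpha> \<in> hom Z T" by (rule hom_compose)
  then show ?thesis
    by unfold_locales (simp add: proj_def[abs_def] comp_def)
qed

sublocale P: group_hom Z T proj by (rule proj_hom)

lemma sec_hom: "group_hom T Z sec"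
proof (unfold_locales, rule homI)
  fix t u assume "t \<in> carrier T" "u \<in> carrier T"
  then show "sec t \<in> carrier Z" "sec (t \<otimes>\<^bsub>T\<^esub> u) = sec t \<otimes>\<^bsub>Z\<^esub> sec u"
    using A.hom_closed[of "(t, \<one>\<^bsub>M\<^esub>)"] A.hom_mult[of "(t, \<one>\<^bsub>M\<^esub>)" "(u, \<one>\<^bsub>M\<^esub>)"]
    by (simp_all add: sec_def)
qed

sublocale S: group_hom T Z sec by (rule sec_hom)

lemma proj_\<alpha>: "t \<in> carrier T \<Longrightarrow> c \<in> carrier M \<Longrightarrow> proj (\<alpha> (t, c)) = t"
  using \<alpha> by (simp add: proj_def iso_def bij_betw_def inv_into_f_f)

lemma proj_sec: "t \<in> carrier T \<Longrightarrow> proj (sec t) = t"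
  by (simp add: sec_def proj_\<alpha>)

lemma Z_cases:
  assumes "z \<in> carrier Z"
  obtains t c where "t \<in> carrier T" "c \<in> carrier M" "z = \<alpha> (t, c)"
proof -
  have "z \<in> \<alpha> ` carrier (T \<times>\<times> M)" using assms \<alpha> by (simp add: iso_def bij_betw_def)
  with that show thesis by auto
qed

lemma free_part_kernel: "F = kernel Z T proj"
proof (intro equalityI subsetI)
  fix z assume "z \<in> F"
  then show "z \<in> kernel Z T proj"
    using A.hom_closed by (auto simp: free_part_def kernel_def proj_\<alpha> simp del: carrier_Z0_group)
next
  fix z assume "z \<in> kernel Z T proj"
  then have z: "z \<in> carrier Z" "proj z = \<one>\<^bsub>T\<^esub>" by (auto simp: kernel_def)
  from z(1) obtain t c where "t \<in> carrier T" "c \<in> carrier M" "z = \<alpha> (t, c)" by (rule Z_cases)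
  with z(2) show "z \<in> F" by (auto simp: free_part_def proj_\<alpha>)
qed

lemma normal_free_part: "F \<lhd> E"
proof (rule Th.G.normal_invI)
  have "subgroup F Z" unfolding free_part_kernel by (rule P.subgroup_kernel)
  then show "subgroup F E"
    unfolding Z0_group_def by (rule Th.G.incl_subgroup[OF Th.subgroup_kernel])
  fix x h assume x: "x \<in> carrier E" and h: "h \<in> F"
  from h have "h \<in> center E"
    using env_theta_kernel_central by (auto simp: free_part_kernel kernel_def)
  then have "x \<otimes>\<^bsub>E\<^esub> h = h \<otimes>\<^bsub>E\<^esub> x" "h \<in> carrier E"
    using x by (auto simp: center_def)
  then show "x \<otimes>\<^bsub>E\<^esub> h \<otimes>\<^bsub>E\<^esub> inv\<^bsub>E\<^esub> x \<in> F"
    using x h by (simp add: Th.G.m_assoc)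
qed

sublocale F: normal F E by (rule normal_free_part)

abbreviation "coset \<equiv> \<lambda>g. F #>\<^bsub>E\<^esub> g"

lemma group_E\<alpha>: "group E\<^sub>\<alpha>"
  unfolding env_quotient_def by (rule F.factorgroup_is_group)

lemma coset_group_hom: "group_hom E E\<^sub>\<alpha> coset"
  using group_E\<alpha>
  by (simp add: group_hom_def group_hom_axioms_def group_env env_quotient_def F.r_coset_hom_Mod)

sublocale C: group_hom E E\<^sub>\<alpha> coset by (rule coset_group_hom)

lemma carrier_E\<alpha>: "carrier E\<^sub>\<alpha> = coset ` carrier E"
  by (simp add: env_quotient_def carrier_FactGroup)

lemma theta_bar_coset: "g \<in> carrier E \<Longrightarrow> \<theta>' (coset g) = \<theta> g"
  by (rule env_theta_bar_coset[OF \<alpha>])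

lemma theta_bar_group_hom: "group_hom E\<^sub>\<alpha> (Inn Q (\<triangleright>)) \<theta>'"
proof (unfold_locales, rule homI)
  fix A B assume "A \<in> carrier E\<^sub>\<alpha>" "B \<in> carrier E\<^sub>\<alpha>"
  then obtain g h where gh: "g \<in> carrier E" "h \<in> carrier E" "A = coset g" "B = coset h"
    by (auto simp: carrier_E\<alpha>)
  then show "\<theta>' A \<in> carrier (Inn Q (\<triangleright>))" by (simp add: theta_bar_coset)
  show "\<theta>' (A \<otimes>\<^bsub>E\<^sub>\<alpha>\<^esub> B) = \<theta>' A \<otimes>\<^bsub>Inn Q (\<triangleright>)\<^esub> \<theta>' B"
    using gh by (simp add: theta_bar_coset flip: C.hom_mult)
qed

sublocale B: group_hom E\<^sub>\<alpha> "Inn Q (\<triangleright>)" \<theta>' by (rule theta_bar_group_hom)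

lemma theta_bar_surj: "\<theta>' ` carrier E\<^sub>\<alpha> = carrier (Inn Q (\<triangleright>))"
  by (simp add: carrier_E\<alpha> image_image theta_bar_coset env_theta_surj)

lemma sec_closed: "t \<in> carrier T \<Longrightarrow> sec t \<in> carrier E"
  using S.hom_closed[of t] by (simp add: kernel_def)

lemma coset_eq_iff:
  assumes "y \<in> carrier Z" "z \<in> carrier Z"
  shows "coset y = coset z \<longleftrightarrow> proj y = proj z"
proof -
  have yz: "y \<in> carrier E" "z \<in> carrier E" using assms by (auto simp: kernel_def)
  have "inv\<^bsub>Z\<^esub> z = inv\<^bsub>E\<^esub> z"
    unfolding Z0_group_def using assms
    by (intro Th.G.m_inv_consistent Th.subgroup_kernel) simp
  moreover have "y \<otimes>\<^bsub>Z\<^esub> inv\<^bsub>Z\<^esub> z \<in> F \<longleftrightarrow> proj y \<otimes>\<^bsub>T\<^esub> inv\<^bsub>T\<^esub> (proj z) = \<one>\<^bsub>T\<^esub>"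
    using assms by (simp add: free_part_kernel kernel_def[of Z] del: carrier_Z0_group mult_Z0_group)
  moreover have "\<dots> \<longleftrightarrow> proj y = proj z"
    using assms P.hom_closed by (subst T.inv_solve_right') auto
  moreover have "coset y = coset z \<longleftrightarrow> y \<otimes>\<^bsub>E\<^esub> inv\<^bsub>E\<^esub> z \<in> F"
    using F.rcos_module[OF Th.G.is_group yz(2,1)] yz
      Th.G.repr_independence[OF _ yz(2) F.subgroup_axioms] Th.G.rcos_self[OF yz(1) F.subgroup_axioms]
    by blast
  ultimately show ?thesis by simp
qed

lemma kernel_theta_bar: "kernel E\<^sub>\<alpha> (Inn Q (\<triangleright>)) \<theta>' = (coset \<circ> sec) ` carrier T"
proof (intro equalityI subsetI)
  fix A assume "A \<in> kernel E\<^sub>\<alpha> (Inn Q (\<triangleright>)) \<theta>'"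
  then obtain z where z: "z \<in> carrier Z" and A: "A = coset z"
    by (auto simp: kernel_def carrier_E\<alpha> theta_bar_coset)
  have "coset (sec (proj z)) = coset z"
    using z by (subst coset_eq_iff) (simp_all add: proj_sec del: carrier_Z0_group)
  with A z show "A \<in> (coset \<circ> sec) ` carrier T"
    using P.hom_closed[OF z] by (intro image_eqI[of _ _ "proj z"]) auto
next
  fix A assume "A \<in> (coset \<circ> sec) ` carrier T"
  then obtain t where "t \<in> carrier T" "A = coset (sec t)" by auto
  then show "A \<in> kernel E\<^sub>\<alpha> (Inn Q (\<triangleright>)) \<theta>'"
    using S.hom_closed[of t] by (auto simp: kernel_def theta_bar_coset)
qed

lemma Tor_iso_nucleus: "coset \<circ> sec \<in> iso T (nucleus E\<^sub>\<alpha> (Inn Q (\<triangleright>)) \<theta>')"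
proof (rule isoI)
  show "coset \<circ> sec \<in> hom T (nucleus E\<^sub>\<alpha> (Inn Q (\<triangleright>)) \<theta>')"
  proof (rule homI)
    fix t u assume t: "t \<in> carrier T" and u: "u \<in> carrier T"
    show "(coset \<circ> sec) t \<in> carrier (nucleus E\<^sub>\<alpha> (Inn Q (\<triangleright>)) \<theta>')"
      using t by (simp add: nucleus_def kernel_theta_bar)
    have "sec (t \<otimes>\<^bsub>T\<^esub> u) = sec t \<otimes>\<^bsub>E\<^esub> sec u" using S.hom_mult[OF t u] by simp
    then show "(coset \<circ> sec) (t \<otimes>\<^bsub>T\<^esub> u)
        = (coset \<circ> sec) t \<otimes>\<^bsub>nucleus E\<^sub>\<alpha> (Inn Q (\<triangleright>)) \<theta>'\<^esub> (coset \<circ> sec) u"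
      using t u by (simp add: nucleus_def sec_closed)
  qed
  show "bij_betw (coset \<circ> sec) (carrier T) (carrier (nucleus E\<^sub>\<alpha> (Inn Q (\<triangleright>)) \<theta>'))"
  proof (rule bij_betw_imageI)
    show "inj_on (coset \<circ> sec) (carrier T)"
    proof (rule inj_onI)
      fix t u assume tu: "t \<in> carrier T" "u \<in> carrier T" "(coset \<circ> sec) t = (coset \<circ> sec) u"
      then have "proj (sec t) = proj (sec u)"
        using coset_eq_iff[of "sec t" "sec u"] by (simp del: carrier_Z0_group)
      with tu show "t = u" by (simp add: proj_sec)
    qed
  qed (simp add: nucleus_def kernel_theta_bar)
qed

lemma nucleus_central: "kernel E\<^sub>\<alpha> (Inn Q (\<triangleright>)) \<theta>' \<subseteq> center E\<^sub>\<alpha>"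
proof
  fix A assume "A \<in> kernel E\<^sub>\<alpha> (Inn Q (\<triangleright>)) \<theta>'"
  then obtain t where t: "t \<in> carrier T" and A: "A = coset (sec t)"
    by (auto simp: kernel_theta_bar)
  have z: "sec t \<in> center E"
    using S.hom_closed[OF t] env_theta_kernel_central by auto
  have "A \<otimes>\<^bsub>E\<^sub>\<alpha>\<^esub> coset g = coset g \<otimes>\<^bsub>E\<^sub>\<alpha>\<^esub> A" if "g \<in> carrier E" for g
    using z that by (simp add: A center_def flip: C.hom_mult)
  then show "A \<in> center E\<^sub>\<alpha>"
    using t by (auto simp: center_def carrier_E\<alpha> A sec_closed)
qed

lemma nucleus_derived:
  assumes "finite Q"
  shows "kernel E\<^sub>\<alpha> (Inn Q (\<triangleright>)) \<theta>' \<subseteq> derived E\<^sub>\<alpha> (carrier E\<^sub>\<alpha>)"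
proof
  fix A assume "A \<in> kernel E\<^sub>\<alpha> (Inn Q (\<triangleright>)) \<theta>'"
  then obtain t where t: "t \<in> carrier T" and A: "A = coset (sec t)"
    by (auto simp: kernel_theta_bar)
  from t obtain n :: nat where n: "n > 0" "t [^]\<^bsub>T\<^esub> n = \<one>\<^bsub>T\<^esub>"
    by (auto simp: Tor_group_def torsion_def nat_pow_def)
  have "sec t [^]\<^bsub>E\<^esub> n = \<one>\<^bsub>E\<^esub>"
    using S.hom_nat_pow[OF t, of n] n by (simp add: pow_Z0_group)
  with t n have "sec t \<in> derived E (carrier E)"
    by (intro torsion_in_derived[OF assms]) (auto simp: sec_closed)
  then show "A \<in> derived E\<^sub>\<alpha> (carrier E\<^sub>\<alpha>)"
    using C.derived_img[of "carrier E"] by (simp add: A carrier_E\<alpha>)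
qed

lemma finite_Tor:
  assumes "finite Q"
  shows "finite (carrier T)"
proof -
  have "finite (\<theta> ` carrier E)" using finite_Inn[OF assms] by (simp add: env_theta_surj)
  then obtain Y where Y: "finite Y" "Y \<subseteq> carrier E" "generate E Y = kernel E (Inn Q (\<triangleright>)) \<theta>"
    using Th.finitely_generated_kernel[of "gen ` Q"] assms
    by (auto simp: gen_closed env_generate image_subset_iff)
  have YZ: "Y \<subseteq> carrier Z" by (auto intro: generate.incl simp flip: Y(3))
  have "generate Z Y = carrier Z"
    using Th.G.generate_consistent[OF _ Th.subgroup_kernel, of Y] YZ Y(3)
    by (simp add: Z0_group_def)
  then have "generate T (proj ` Y) = proj ` carrier Z"
    using P.generate_img[OF YZ] by simp
  also have "\<dots> = carrier T"
  proof
    show "proj ` carrier Z \<subseteq> carrier T" using P.hom_closed by blast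
    show "carrier T \<subseteq> proj ` carrier Z"
      using S.hom_closed proj_sec by (metis image_eqI subsetI)
  qed
  finally have gen_T: "generate T (proj ` Y) = carrier T" .
  have "carrier T \<subseteq> torsion T"
    by (auto simp: Tor_group_def torsion_def nat_pow_def)
  then have "proj ` Y \<subseteq> torsion T"
    using YZ P.hom_closed by blast
  then have "finite (generate T (proj ` Y))"
    using Y(1) by (intro T.finite_generate_torsion finite_imageI)
  then show ?thesis by (simp add: gen_T)
qed

end

theorem proposition3p4:
  fixes Q :: "'a set" and op :: "'a \<Rightarrow> 'a \<Rightarrow> 'a"
    and \<alpha> :: "'a word set \<times> 'a word set set \<Rightarrow> 'a word set"
  assumes "quandle Q op" and "finite Q"
    and "\<alpha> \<in> iso (Tor_group Q op \<times>\<times> Z0_mod_Tor Q op) (Z0_group Q op)"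
  shows "(stem_extension (env_quotient Q op \<alpha>) (Inn Q op) (env_theta_bar Q op)
          \<and> nucleus (env_quotient Q op \<alpha>) (Inn Q op) (env_theta_bar Q op) \<cong> Tor_group Q op
          \<and> finite (carrier (Tor_group Q op)))
         \<and> finite (carrier (env_quotient Q op \<alpha>))"
proof -
  interpret quandle_splitting Q op \<alpha>
    using assms by (simp add: quandle_splitting_def quandle_splitting_axioms_def)
  have "stem_extension E\<^sub>\<alpha> (Inn Q op) \<theta>'"
    using B.homh theta_bar_surj nucleus_central nucleus_derived[OF assms(2)]
    by (simp add: stem_extension_def group_E\<alpha> group_Inn epi_def)
  moreover have "nucleus E\<^sub>\<alpha> (Inn Q op) \<theta>' \<cong> T"
    using T.iso_sym[OF is_isoI[OF Tor_iso_nucleus]] .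
  moreover have "finite (carrier E\<^sub>\<alpha>)"
    using finite_Tor[OF assms(2)] finite_Inn[OF assms(2)]
    by (intro B.finite_carrier_if_finite_kernel_image)
      (simp_all add: kernel_theta_bar theta_bar_surj)
  ultimately show ?thesis using finite_Tor[OF assms(2)] by simp
qed

end
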